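(* Let $A\in\mathbb{R}^{m\times n}$ have non-negative entries with $\max_{i\in[m]}A_{ij}=1$ for all $j\in[n]$, and let $x^\ast$ be the optimizer of $\max\left\{\sum_{i=1}^n\log x_i: x\in\mathbb{R}^n_{\ge0},\ Ax\le\mathbb{1}_m\right\}$. Then $x^\ast_i\ge 1/n$ for all $i\in[n]$.
   Context: $\mathbb{1}_m$ is the all-ones vector in $\mathbb{R}^m$, vector inequalities are entrywise, and $\log 0=-\infty$. *)

theory Defs
  imports "HOL-Analysis.Analysis"
begin

(* The library's ln has ln 0 = 0; the convention log 0 = -\<infinity> is needed instead.
   Negative arguments never occur at feasible points. *)
definition elog :: "real \<Rightarrow> ereal" where
  "elog t = (if t > 0 then ereal (ln t) else -\<infinity>)"

definition log_utility :: "real^'n \<Rightarrow> ereal" where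
  "log_utility x = (\<Sum>i\<in>UNIV. elog (x $ i))"

(* On vectors, \<le> is entrywise and the constants 0 and 1 are the all-zeros and all-ones vectors. *)
definition packing_feasible :: "real^'n^'m \<Rightarrow> real^'n \<Rightarrow> bool" where
  "packing_feasible A x \<longleftrightarrow> 0 \<le> x \<and> A *v x \<le> 1"

end

(* If x maximises the utility, then for every k and s > 0 the feasible point
   (x + s e_k) / (1 + s), a convex combination of x and the k-th unit vector, has no larger utility:
   ln (1 + s / x_k) <= n ln (1 + s).  As ln (1 + u) lies between u / (1 + u) and u, this gives
   1 / n <= x_k + s for all s > 0. *)
theory Submission
  imports Defs
begin

lemma log_utility_pos:
  assumes "\<And>i. x $ i > 0"
  shows "log_utility x = ereal (\<Sum>i\<in>UNIV. ln (x $ i))"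
  using assms by (simp add: log_utility_def elog_def)

lemma log_utility_eq_MInf:
  assumes "x $ k \<le> 0"
  shows "log_utility x = -\<infinity>"
proof -
  \<comment> \<open>In \<open>ereal\<close>, \<open>-\<infinity> + \<infinity>\<close> is
    \<open>\<infinity>\<close>, so the term at \<open>k\<close> decides the sum only once the rest
    is known not to be \<open>\<infinity>\<close>; no value of \<open>elog\<close> is.\<close>
  have "(\<Sum>i\<in>UNIV - {k}. elog (x $ i)) \<noteq> \<infinity>"
    by (simp add: sum_Pinfty elog_def)
  then show ?thesis
    using assms by (simp add: log_utility_def sum.remove[of UNIV k] elog_def)
qed

lemma packing_feasible_iff:
  "packing_feasible A x \<longleftrightarrow>
    (\<forall>j. 0 \<le> x $ j) \<and> (\<forall>i. (\<Sum>j\<in>UNIV. A $ i $ j * x $ j) \<le> 1)"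
  by (simp add: packing_feasible_def less_eq_vec_def matrix_vector_mult_def)

text \<open>Provides a feasible point of finite utility, which rules out optimizers with a vanishing
  coordinate.\<close>

lemma packing_feasible_uniform:
  fixes A :: "real^'n^'m"
  assumes "\<And>i j. A $ i $ j \<le> 1"
  shows "packing_feasible A (\<chi> j. 1 / real CARD('n))"
proof -
  have "(\<Sum>j\<in>UNIV. A $ i $ j * (1 / real CARD('n))) \<le> (\<Sum>j\<in>(UNIV :: 'n set). 1 / real CARD('n))" for i
    using assms by (intro sum_mono) (simp add: divide_right_mono)
  then show ?thesis
    by (simp add: packing_feasible_iff)
qed

text \<open>\<open>A\<close> maps \<open>axis k 1\<close> to its column \<open>k\<close>, whose
  entries are at most 1, so moving by \<open>s\<close> along this axis raises each constraint by at
  most \<open>s\<close>; dividing by \<open>1 + s\<close> restores the bound 1.\<close>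

lemma packing_feasible_convex_axis:
  fixes A :: "real^'n^'m"
  assumes le1: "\<And>i j. A $ i $ j \<le> 1" and feas: "packing_feasible A x" and "s \<ge> 0"
  shows "packing_feasible A ((1 / (1 + s)) *\<^sub>R (x + s *\<^sub>R axis k 1))"
proof -
  have "A *v ((1 / (1 + s)) *\<^sub>R (x + s *\<^sub>R axis k 1)) =
      (1 / (1 + s)) *\<^sub>R (A *v x + s *\<^sub>R column k A)"
    by (simp add: matrix_vector_mult_scaleR matrix_vector_right_distrib matrix_vector_mult_basis)
  moreover have "(A *v x) $ i + s * A $ i $ k \<le> 1 + s" for i
  proof (rule add_mono)
    show "(A *v x) $ i \<le> 1"
      using feas by (simp add: packing_feasible_def less_eq_vec_def)
    show "s * A $ i $ k \<le> s"
      using mult_left_mono[OF le1 \<open>s \<ge> 0\<close>] by simp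
  qed
  moreover have "0 \<le> x $ j" for j
    using feas by (simp add: packing_feasible_iff)
  ultimately show ?thesis
    using \<open>s \<ge> 0\<close>
    by (simp add: packing_feasible_def less_eq_vec_def column_def axis_def divide_simps)
qed

text \<open>Every coordinate is divided by \<open>1 + s\<close>, and coordinate \<open>k\<close>
  alone also gains the factor \<open>1 + s / x $ k\<close>.\<close>

lemma sum_ln_convex_axis:
  fixes x :: "real^'n"
  assumes pos: "\<And>i. x $ i > 0" and "s > 0"
  shows "(\<Sum>i\<in>UNIV. ln (((1 / (1 + s)) *\<^sub>R (x + s *\<^sub>R axis k 1)) $ i)) =
    (\<Sum>i\<in>UNIV. ln (x $ i)) + ln (1 + s / x $ k) - real CARD('n) * ln (1 + s)"
proof -
  have "ln (((1 / (1 + s)) *\<^sub>R (x + s *\<^sub>R axis k 1)) $ i) =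
      ln (x $ i) + (if i = k then ln (1 + s / x $ k) else 0) - ln (1 + s)" for i
  proof (cases "i = k")
    case True
    have "x $ k + s = x $ k * (1 + s / x $ k)"
      using pos[of k] by (simp add: field_simps)
    then have "ln (x $ k + s) = ln (x $ k) + ln (1 + s / x $ k)"
      using pos[of k] \<open>s > 0\<close> by (simp add: ln_mult_pos add_pos_pos)
    then show ?thesis
      using True pos[of k] \<open>s > 0\<close> by (simp add: axis_def ln_div)
  next
    case False
    then show ?thesis
      using pos[of i] \<open>s > 0\<close> by (simp add: axis_def ln_div)
  qed
  then show ?thesis
    by (simp add: sum.distrib sum_subtractf)
qed

theorem lemma12:
  fixes A :: "real^'n^'m" and xs :: "real^'n"
  assumes nonneg: "\<forall>i j. A $ i $ j \<ge> 0"
    and colmax: "\<forall>j. (MAX i. A $ i $ j) = 1"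
    and opt: "is_arg_max log_utility (packing_feasible A) xs"
  shows "\<forall>i. xs $ i \<ge> 1 / real CARD('n)"
proof
  fix k
  have le1: "A $ i $ j \<le> 1" for i j
    using colmax Max_ge[of "range (\<lambda>i. A $ i $ j)" "A $ i $ j"] by simp
  have feas: "packing_feasible A xs"
    and max: "\<And>y. packing_feasible A y \<Longrightarrow> log_utility y \<le> log_utility xs"
    using opt by (auto simp: is_arg_max_def not_less)
  have pos: "xs $ i > 0" for i
  proof (rule ccontr)
    assume "\<not> xs $ i > 0"
    then have "log_utility xs = -\<infinity>"
      by (simp add: log_utility_eq_MInf[of xs i])
    then show False
      using max[OF packing_feasible_uniform[OF le1]] by (simp add: log_utility_pos)
  qed
  show "1 / real CARD('n) \<le> xs $ k"
  proof (rule field_le_epsilon)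
    fix s :: real
    assume s: "s > 0"
    define y where "y = (1 / (1 + s)) *\<^sub>R (xs + s *\<^sub>R axis k 1)"
    \<comment> \<open>Together with \<open>pos\<close>, this makes both utilities finite, so that
      optimality becomes an inequality between real sums.\<close>
    have ypos: "y $ i > 0" for i
      using pos[of i] s by (auto simp: y_def axis_def intro!: divide_pos_pos add_pos_pos)
    have "packing_feasible A y"
      unfolding y_def using le1 feas s by (intro packing_feasible_convex_axis) auto
    from max[OF this] have "(\<Sum>i\<in>UNIV. ln (y $ i)) \<le> (\<Sum>i\<in>UNIV. ln (xs $ i))"
      by (simp add: log_utility_pos pos ypos)
    then have "ln (1 + s / xs $ k) \<le> real CARD('n) * ln (1 + s)"
      unfolding y_def sum_ln_convex_axis[OF pos s] by simp
    also have "\<dots> \<le> real CARD('n) * s"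
      using s by (intro mult_left_mono ln_add_one_self_le_self) auto
    finally have upper: "ln (1 + s / xs $ k) \<le> real CARD('n) * s" .
    \<comment> \<open>The lower bound on the logarithm is \<open>ln v \<le> v - 1\<close> taken at
      the reciprocal, with signs reversed.\<close>
    have "1 - inverse (1 + s / xs $ k) \<le> ln (1 + s / xs $ k)"
      using pos[of k] s ln_le_minus_one[of "inverse (1 + s / xs $ k)"]
      by (simp add: ln_inverse add_pos_pos)
    also have "1 - inverse (1 + s / xs $ k) = s / (xs $ k + s)"
      using pos[of k] s by (simp add: field_simps add_pos_pos)
    \<comment> \<open>Both bounds are linear in the factor \<open>s\<close>, which cancels because
      it is positive; taking reciprocals then gives the claim.\<close>
    finally have "s * (1 / (xs $ k + s)) \<le> s * real CARD('n)"
      using upper by (simp add: mult.commute)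
    then have "1 / (xs $ k + s) \<le> real CARD('n)"
      using s by (simp only: mult_le_cancel_left_pos)
    then show "1 / real CARD('n) \<le> xs $ k + s"
      using pos[of k] s by (simp add: field_simps add_pos_pos)
  qed
qed

end
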